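(* Let $k\ge 1$ and let $X=X_{\mathcal{F}}$ be a $k$-dimensional shift of finite type. Then there exists a $k$-dimensional graph $G=(H_1,\dots,H_k)$ such that $X$ is conjugate to $X_G$.
   Context: Let $\mathcal{A}$ be a finite alphabet with the discrete topology and give $\mathcal{A}^{\mathbb{Z}^k}$ the product topology. For $a\in\mathbb{Z}^k$ the shift map $\sigma_a$ is $(\sigma_a(x))(v)=x(v+a)$. A $k$-dimensional shift space is a set $X_{\mathcal{F}}\subseteq \mathcal{A}^{\mathbb{Z}^k}$ consisting of all $x$ in which no translate of a pattern from a given set $\mathcal{F}$ of finite patterns appears; it is of finite type if $\mathcal{F}$ can be chosen to be finite. Two shift spaces are conjugate if there is a homeomorphism between them commuting with all shift maps $\sigma_a$, $a\in\mathbb{Z}^k$. A $k$-dimensional graph is a tuple $G=(H_1,\dots,H_k)$ of directed graphs (at most one edge for each ordered pair of vertices, loops allowed) on a common finite vertex set $\mathcal{V}$. The shift space $X_G$ generated by $G$ is the set of all $x\in\mathcal{V}^{\mathbb{Z}^k}$ such that for every $v\in\mathbb{Z}^k$ and every $i\in\{1,\dots,k\}$ there is an edge of $H_i$ from $x(v)$ to $x(v+e_i)$, where $e_i$ is the $i$-th standard basis vector. *)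

theory Defs
  imports "HOL-Analysis.Analysis" "Graph_Theory.Pair_Digraph"
begin

text \<open>
  The lattice \<open>\<int>\<^sup>k\<close> is the type \<open>int ^ 'k\<close> with \<open>k = CARD('k)\<close>, so that \<open>k \<ge> 1\<close> holds
  automatically and \<open>axis i 1\<close> is the \<open>i\<close>-th standard basis vector.  Alphabets are (finite) sets
  \<open>A :: 'a set\<close> rather than types.
\<close>

type_synonym ('k, 'a) config = "int ^ 'k \<Rightarrow> 'a"

type_synonym ('k, 'a) pattern = "int ^ 'k \<rightharpoonup> 'a"

definition full_shift :: "'a set \<Rightarrow> ('k::finite, 'a) config topology" where
  "full_shift A = product_topology (\<lambda>_. discrete_topology A) UNIV"

definition shift :: "int ^ 'k \<Rightarrow> ('k::finite, 'a) config \<Rightarrow> ('k, 'a) config" where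
  "shift a x = (\<lambda>v. x (v + a))"

definition patterns :: "'a set \<Rightarrow> ('k::finite, 'a) pattern set" where
  "patterns A = {p. finite (dom p) \<and> ran p \<subseteq> A}"

definition appears :: "('k::finite, 'a) pattern \<Rightarrow> ('k, 'a) config \<Rightarrow> bool" where
  "appears p x \<longleftrightarrow> (\<exists>a. \<forall>v\<in>dom p. p v = Some (x (v + a)))"

definition shift_space :: "'a set \<Rightarrow> ('k::finite, 'a) pattern set \<Rightarrow> ('k, 'a) config set" where
  "shift_space A \<F> = {x \<in> topspace (full_shift A). \<forall>p\<in>\<F>. \<not> appears p x}"

definition is_shift_space :: "'a set \<Rightarrow> ('k::finite, 'a) config set \<Rightarrow> bool" where
  "is_shift_space A X \<longleftrightarrow> (\<exists>\<F>. \<F> \<subseteq> patterns A \<and> X = shift_space A \<F>)"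

definition shift_of_finite_type :: "'a set \<Rightarrow> ('k::finite, 'a) config set \<Rightarrow> bool" where
  "shift_of_finite_type A X \<longleftrightarrow> (\<exists>\<F>. finite \<F> \<and> \<F> \<subseteq> patterns A \<and> X = shift_space A \<F>)"

definition conjugate ::
  "'a set \<Rightarrow> ('k::finite, 'a) config set \<Rightarrow> 'b set \<Rightarrow> ('k, 'b) config set \<Rightarrow> bool" where
  "conjugate A X B Y \<longleftrightarrow>
     is_shift_space A X \<and> is_shift_space B Y \<and>
     (\<exists>f. homeomorphic_map (subtopology (full_shift A) X) (subtopology (full_shift B) Y) f \<and>
          (\<forall>a. \<forall>x\<in>X. f (shift a x) = shift a (f x)))"

definition kgraph :: "'v set \<Rightarrow> ('k::finite \<Rightarrow> 'v pair_pre_digraph) \<Rightarrow> bool" where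
  "kgraph V H \<longleftrightarrow> finite V \<and> (\<forall>i. pair_fin_digraph (H i) \<and> pverts (H i) = V)"

definition graph_shift ::
  "'v set \<Rightarrow> ('k::finite \<Rightarrow> 'v pair_pre_digraph) \<Rightarrow> ('k, 'v) config set" where
  "graph_shift V H =
     {x \<in> topspace (full_shift V). \<forall>v i. (x v, x (v + axis i 1)) \<in> parcs (H i)}"

lemma is_shift_space_graph_shift:
  fixes H :: "'k::finite \<Rightarrow> 'v pair_pre_digraph"
  shows "is_shift_space V (graph_shift V H)"
proof -
  define pat :: "'k \<Rightarrow> 'v \<Rightarrow> 'v \<Rightarrow> ('k, 'v) pattern"
    where "pat = (\<lambda>i a b. [0 \<mapsto> a, axis i 1 \<mapsto> b])"
  define \<F> where "\<F> = {pat i a b | i a b. a \<in> V \<and> b \<in> V \<and> (a, b) \<notin> parcs (H i)}"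
  have ne: "axis i 1 \<noteq> (0 :: int ^ 'k)" for i
    by (simp add: axis_eq_0_iff)
  have dom: "dom (pat i a b) = {0, axis i 1}" for i a b
    by (auto simp: pat_def)
  have app: "appears (pat i a b) x \<longleftrightarrow> (\<exists>v. x v = a \<and> x (v + axis i 1) = b)" for i a b x
    using ne[of i] unfolding appears_def dom by (auto simp: pat_def add.commute)
  have "\<F> \<subseteq> patterns V"
    by (auto simp: \<F>_def patterns_def dom) (auto simp: pat_def ran_def split: if_splits)
  moreover have "graph_shift V H = shift_space V \<F>"
  proof (rule set_eqI)
    fix x :: "('k, 'v) config"
    have "x u \<in> V" if "x \<in> topspace (full_shift V)" for u
      using that by (auto simp: full_shift_def)
    moreover have "(\<forall>p\<in>\<F>. \<not> appears p x) \<longleftrightarrow>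
        (\<forall>i a b. a \<in> V \<and> b \<in> V \<and> (a, b) \<notin> parcs (H i) \<longrightarrow> \<not> appears (pat i a b) x)"
      unfolding \<F>_def by blast
    ultimately show "x \<in> graph_shift V H \<longleftrightarrow> x \<in> shift_space V \<F>"
      unfolding graph_shift_def shift_space_def mem_Collect_eq app by metis
  qed
  ultimately show ?thesis
    unfolding is_shift_space_def by blast
qed

end

theory Submission
  imports Defs
begin

text \<open>
  The conjugacy is the higher block code.  Finitely many finite forbidden patterns all fit into one
  box around the origin, so membership of \<open>x\<close> in \<open>X\<close> can be tested by looking through a box-shaped
  window at every position of \<open>x\<close>.  The vertices of the graph are the legal window contents, and
  \<open>H\<^sub>i\<close> joins a block to a second one if the second can be the view through the same window after
  moving one step in direction \<open>i\<close>, that is, if they agree where the two windows overlap.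
  Recording what the window shows at every position maps \<open>X\<close> into the shift of this graph.

  The converse is the heart of the matter: edges only compare windows one unit step apart, so it
  has to be shown that a compatible field of blocks comes from a single configuration.  A cell \<open>w\<close>
  of a box is joined to the central cell by a lattice path inside the box; following that path and
  using one edge for each step, the symbol that the block at \<open>v\<close> has in cell \<open>w\<close> is the central
  symbol of the block at \<open>v + w\<close> (lemma \<open>overlap_center\<close>).  Hence the field of central symbols
  determines all blocks, and reading it off inverts the window map.  Both maps compute each symbol
  of the image from finitely many symbols of the argument, which makes them continuous for the
  product topologies (lemma \<open>continuous_map_local\<close>).  Numbering the finitely many blocks turns them
  into natural numbers.
\<close>

section \<open>Continuity of locally determined maps\<close>

lemma openin_cylinder:
  fixes x :: "('k::finite, 'a) config"
  assumes "finite S" "x \<in> topspace (full_shift A)"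
  shows "openin (full_shift A) {z \<in> topspace (full_shift A). \<forall>w\<in>S. z w = x w}"
proof -
  have "{z \<in> topspace (full_shift A). \<forall>w\<in>S. z w = x w} =
      (\<Pi>\<^sub>E w\<in>UNIV. if w \<in> S then {x w} else A)"
    using assms(2) by (auto simp: full_shift_def PiE_iff split: if_splits)
  moreover have "openin (full_shift A) (\<Pi>\<^sub>E w\<in>UNIV. if w \<in> S then {x w} else A)"
    unfolding full_shift_def
  proof (rule product_topology_basis)
    show "openin (discrete_topology A) (if w \<in> S then {x w} else A)" for w
      using assms(2) by (auto simp: full_shift_def)
    show "finite {w. (if w \<in> S then {x w} else A) \<noteq> topspace (discrete_topology A)}"
      by (rule finite_subset[OF _ \<open>finite S\<close>]) auto
  qed
  ultimately show ?thesis by simp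
qed

text \<open>
  Into a product of discrete spaces, continuity is local constancy of every coordinate
  \<open>x \<mapsto> f x v\<close>.  Such a coordinate is constant on the configurations that agree with a given one
  on \<open>S v\<close>, and these form an open cylinder because \<open>S v\<close> is finite.
\<close>

lemma continuous_map_local:
  fixes f :: "('k::finite, 'a) config \<Rightarrow> ('k, 'b) config"
  assumes X: "X \<subseteq> topspace (full_shift A)" and Y: "Y \<subseteq> topspace (full_shift B)"
    and f: "\<And>x. x \<in> X \<Longrightarrow> f x \<in> Y"
    and S: "\<And>v. finite (S v)"
    and loc: "\<And>v x z. x \<in> X \<Longrightarrow> z \<in> X \<Longrightarrow> (\<And>w. w \<in> S v \<Longrightarrow> z w = x w) \<Longrightarrow> f z v = f x v"
  shows "continuous_map (subtopology (full_shift A) X) (subtopology (full_shift B) Y) f"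
proof -
  let ?T = "subtopology (full_shift A) X"
  have top: "topspace ?T = X"
    using X by auto
  have "continuous_map ?T (discrete_topology B) (\<lambda>x. f x v)" for v
    unfolding continuous_map_def top
  proof (intro conjI allI impI)
    show "(\<lambda>x. f x v) \<in> X \<rightarrow> topspace (discrete_topology B)"
      using f Y by (fastforce simp: full_shift_def)
  next
    fix U
    show "openin ?T {x \<in> X. f x v \<in> U}"
    proof (subst openin_subopen, intro ballI)
      fix x assume x: "x \<in> {x \<in> X. f x v \<in> U}"
      let ?C = "{z \<in> topspace (full_shift A). \<forall>w\<in>S v. z w = x w} \<inter> X"
      have "openin ?T ?C"
        using openin_cylinder[OF S, of x A v] x X by (blast intro: openin_subtopology_Int)
      moreover have "x \<in> ?C"
        using x X by auto
      moreover have "?C \<subseteq> {x \<in> X. f x v \<in> U}"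
      proof
        fix z assume z: "z \<in> ?C"
        then have "f z v = f x v"
          using x by (intro loc) auto
        then show "z \<in> {x \<in> X. f x v \<in> U}"
          using x z by simp
      qed
      ultimately show "\<exists>T. openin ?T T \<and> x \<in> T \<and> T \<subseteq> {x \<in> X. f x v \<in> U}"
        by blast
    qed
  qed
  then have "continuous_map ?T (full_shift B) f"
    by (simp add: full_shift_def continuous_map_componentwise_UNIV)
  then show ?thesis
    using f top by (auto simp: continuous_map_in_subtopology)
qed

section \<open>Boxes\<close>

definition box_at_origin :: "int \<Rightarrow> (int ^ 'k::finite) set" where
  "box_at_origin N = {w. \<forall>i. \<bar>w $ i\<bar> \<le> N}"

lemma finite_box_at_origin: "finite (box_at_origin N :: (int ^ 'k::finite) set)"
proof -
  have "box_at_origin N \<subseteq> vec_lambda ` (\<Pi>\<^sub>E i\<in>(UNIV :: 'k set). {-N..N})"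
  proof
    fix w :: "int ^ 'k" assume "w \<in> box_at_origin N"
    then have abs_le: "\<bar>w $ i\<bar> \<le> N" for i
      by (simp add: box_at_origin_def)
    have "w $ i \<in> {-N..N}" for i
      using abs_le[of i] by auto
    then have "vec_nth w \<in> (\<Pi>\<^sub>E i\<in>UNIV. {-N..N})"
      by (simp add: PiE_UNIV_domain Pi_iff)
    then show "w \<in> vec_lambda ` (\<Pi>\<^sub>E i\<in>UNIV. {-N..N})"
      by (metis imageI vec_nth_inverse)
  qed
  moreover have "finite (\<Pi>\<^sub>E i\<in>(UNIV :: 'k set). {-N..N})"
    by (intro finite_PiE) auto
  ultimately show ?thesis
    by (meson finite_imageI finite_subset)
qed

lemma finite_subset_box_at_origin:
  fixes S :: "(int ^ 'k::finite) set"
  assumes "finite S"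
  obtains N where "0 \<le> N" "S \<subseteq> box_at_origin N"
proof
  let ?N = "\<Sum>w\<in>S. \<Sum>i\<in>UNIV. \<bar>w $ i\<bar>"
  show "0 \<le> ?N" by (intro sum_nonneg) auto
  show "S \<subseteq> box_at_origin ?N"
  proof
    fix w assume "w \<in> S"
    then have "(\<Sum>i\<in>UNIV. \<bar>w $ i\<bar>) \<le> ?N"
      using assms by (intro member_le_sum) (auto intro: sum_nonneg)
    moreover have "\<bar>w $ i\<bar> \<le> (\<Sum>i\<in>UNIV. \<bar>w $ i\<bar>)" for i
      by (intro member_le_sum) auto
    ultimately show "w \<in> box_at_origin ?N"
      unfolding box_at_origin_def using order_trans by blast
  qed
qed

text \<open>
  The sum of the absolute values of the coordinates measures the length of a lattice path to the
  origin; the induction below descends along such a path.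
\<close>

lemma sum_abs_axis_less:
  fixes u w :: "int ^ 'k::finite"
  assumes "\<bar>u $ i\<bar> < \<bar>w $ i\<bar>" "\<And>j. j \<noteq> i \<Longrightarrow> u $ j = w $ j"
  shows "(\<Sum>j\<in>UNIV. nat \<bar>u $ j\<bar>) < (\<Sum>j\<in>UNIV. nat \<bar>w $ j\<bar>)"
proof (rule sum_strict_mono_ex1)
  show "\<forall>j\<in>UNIV. nat \<bar>u $ j\<bar> \<le> nat \<bar>w $ j\<bar>"
    using assms by (metis less_imp_le nat_mono order_refl)
  show "\<exists>j\<in>UNIV. nat \<bar>u $ j\<bar> < nat \<bar>w $ j\<bar>"
    using assms(1) by (intro bexI[of _ i]) auto
qed simp

section \<open>Blocks seen through a window\<close>

definition window :: "int \<Rightarrow> ('k::finite, 'a) config \<Rightarrow> int ^ 'k \<Rightarrow> (int ^ 'k \<Rightarrow> 'a)" where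
  "window N x v = restrict (\<lambda>w. x (v + w)) (box_at_origin N)"

text \<open>
  Only occurrences at the origin are excluded: an occurrence at \<open>a\<close> in a configuration
  is an occurrence at the origin in the window placed at \<open>a\<close>.
\<close>

definition legal_blocks :: "'a set \<Rightarrow> ('k::finite, 'a) pattern set \<Rightarrow> int \<Rightarrow> (int ^ 'k \<Rightarrow> 'a) set" where
  "legal_blocks A \<F> N =
     {b \<in> box_at_origin N \<rightarrow>\<^sub>E A. \<forall>p\<in>\<F>. \<exists>w\<in>dom p. p w \<noteq> Some (b w)}"

definition overlap :: "int \<Rightarrow> 'k \<Rightarrow> (int ^ 'k::finite \<Rightarrow> 'a) \<Rightarrow> (int ^ 'k \<Rightarrow> 'a) \<Rightarrow> bool" where
  "overlap N i b c \<longleftrightarrow>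
     (\<forall>w. w \<in> box_at_origin N \<longrightarrow> w + axis i 1 \<in> box_at_origin N \<longrightarrow> b (w + axis i 1) = c w)"

lemma finite_legal_blocks:
  assumes "finite A"
  shows "finite (legal_blocks A \<F> N)"
  unfolding legal_blocks_def
  by (rule finite_subset[OF _ finite_PiE[OF finite_box_at_origin assms]]) blast

lemma overlap_window: "overlap N i (window N x v) (window N x (v + axis i 1))"
  by (simp add: overlap_def window_def ac_simps)

text \<open>
  Walk from \<open>w\<close> to the origin one unit step at a time, shrinking some coordinate in absolute value
  and hence never leaving the box.  Whenever the cell moves by a step, the window position moves by
  the opposite step; the position looked at stays \<open>v + w\<close>, and the overlap condition
  for the two windows keeps the symbol.
\<close>

lemma overlap_center:
  fixes y :: "int ^ 'k::finite \<Rightarrow> (int ^ 'k \<Rightarrow> 'a)"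
  assumes y: "\<And>v i. overlap N i (y v) (y (v + axis i 1))"
    and "w \<in> box_at_origin N"
  shows "y v w = y (v + w) 0"
  using assms(2)
proof (induction "\<Sum>i\<in>UNIV. nat \<bar>w $ i\<bar>" arbitrary: v w rule: less_induct)
  case less
  show ?case
  proof (cases "w = 0")
    case False
    then obtain i where i: "w $ i \<noteq> 0"
      by (auto simp: vec_eq_iff)
    have box: "u \<in> box_at_origin N"
      if "\<bar>u $ i\<bar> < \<bar>w $ i\<bar>" "\<And>j. j \<noteq> i \<Longrightarrow> u $ j = w $ j" for u
      unfolding box_at_origin_def
    proof (intro CollectI allI)
      fix j
      have "\<bar>u $ j\<bar> \<le> \<bar>w $ j\<bar>" using that by (cases "j = i") auto
      also have "\<dots> \<le> N" using less.prems by (simp add: box_at_origin_def)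
      finally show "\<bar>u $ j\<bar> \<le> N" .
    qed
    show ?thesis
    proof (cases "w $ i > 0")
      case True
      define u where "u = w - axis i 1"
      have u: "\<bar>u $ i\<bar> < \<bar>w $ i\<bar>" "\<And>j. j \<noteq> i \<Longrightarrow> u $ j = w $ j"
        using True by (auto simp: u_def axis_def)
      have "y v w = y (v + axis i 1) u"
        using y[of i v, unfolded overlap_def, rule_format, of u] box[OF u] less.prems
        by (simp add: u_def)
      also have "\<dots> = y (v + axis i 1 + u) 0"
        using less.hyps[OF sum_abs_axis_less[OF u] box[OF u]] .
      finally show ?thesis by (simp add: u_def)
    next
      case False
      define u where "u = w + axis i 1"
      have u: "\<bar>u $ i\<bar> < \<bar>w $ i\<bar>" "\<And>j. j \<noteq> i \<Longrightarrow> u $ j = w $ j"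
        using False i by (auto simp: u_def axis_def)
      \<comment> \<open>Here the window moves backwards, so the edge that ends at \<open>v\<close> is used.\<close>
      have "y v w = y (v - axis i 1) u"
        using y[of i "v - axis i 1"] box[OF u] less.prems by (simp add: overlap_def u_def)
      also have "\<dots> = y (v - axis i 1 + u) 0"
        using less.hyps[OF sum_abs_axis_less[OF u] box[OF u]] .
      finally show ?thesis by (simp add: u_def)
    qed
  qed simp
qed

text \<open>
  A compatible field of blocks is the field of windows of its central symbols.  Legality enters
  through the default value of the block outside the box, which a window has too.
\<close>

lemma window_center:
  assumes "\<And>v i. overlap N i (y v) (y (v + axis i 1))" "y v \<in> legal_blocks A \<F> N"
  shows "window N (\<lambda>v. y v 0) v = y v"
proof
  fix w
  show "window N (\<lambda>v. y v 0) v w = y v w"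
    using overlap_center[of N y w v, OF assms(1)] assms(2)
    by (auto simp: window_def legal_blocks_def PiE_iff extensional_def)
qed

text \<open>
  A forbidden pattern occurs at \<open>v\<close> exactly if the window at \<open>v\<close> shows it at the origin.  For this
  the box has to contain the domains of all patterns: a pattern sticking out of the box would be
  compared with default values of the block.
\<close>

lemma shift_space_iff_legal_windows:
  assumes "0 \<le> N" and dom: "\<And>p. p \<in> \<F> \<Longrightarrow> dom p \<subseteq> box_at_origin N"
  shows "x \<in> shift_space A \<F> \<longleftrightarrow> (\<forall>v. window N x v \<in> legal_blocks A \<F> N)"
proof -
  have "(\<forall>v. window N x v \<in> box_at_origin N \<rightarrow>\<^sub>E A) \<longleftrightarrow> (\<forall>v. x v \<in> A)"
  proof
    assume *: "\<forall>v. window N x v \<in> box_at_origin N \<rightarrow>\<^sub>E A"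
    have "0 \<in> box_at_origin N" using \<open>0 \<le> N\<close> by (simp add: box_at_origin_def)
    then show "\<forall>v. x v \<in> A" using * by (force simp: window_def)
  qed (auto simp: window_def)
  moreover have "appears p x \<longleftrightarrow> (\<exists>v. \<forall>w\<in>dom p. p w = Some (window N x v w))" if "p \<in> \<F>" for p
  proof -
    have "window N x v w = x (w + v)" if "w \<in> dom p" for v w
      using dom[OF \<open>p \<in> \<F>\<close>] that by (auto simp: window_def add.commute)
    then show ?thesis unfolding appears_def by simp
  qed
  ultimately have "x \<in> shift_space A \<F> \<longleftrightarrow>
      (\<forall>v. window N x v \<in> box_at_origin N \<rightarrow>\<^sub>E A) \<and>
      (\<forall>p\<in>\<F>. \<forall>v. \<exists>w\<in>dom p. p w \<noteq> Some (window N x v w))"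
    by (simp add: shift_space_def full_shift_def PiE_UNIV_domain Pi_iff)
  then show ?thesis
    unfolding legal_blocks_def by blast
qed

section \<open>The conjugacy\<close>

theorem corollary3:
  fixes A :: "'a set" and X :: "('k::finite, 'a) config set"
  assumes "finite A" and "shift_of_finite_type A X"
  shows "\<exists>(V :: nat set) (H :: 'k \<Rightarrow> nat pair_pre_digraph).
           kgraph V H \<and> conjugate A X V (graph_shift V H)"
proof -
  obtain \<F> where \<F>: "finite \<F>" "\<F> \<subseteq> patterns A" and X: "X = shift_space A \<F>"
    using assms(2) by (auto simp: shift_of_finite_type_def)
  have "finite (\<Union>p\<in>\<F>. dom p)"
    using \<F> by (auto simp: patterns_def)
  then obtain N where N: "0 \<le> N" "(\<Union>p\<in>\<F>. dom p) \<subseteq> box_at_origin N"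
    by (rule finite_subset_box_at_origin)
  let ?L = "legal_blocks A \<F> N"
  have fin: "finite ?L"
    using assms(1) by (rule finite_legal_blocks)
  then obtain enc :: "(int ^ 'k \<Rightarrow> 'a) \<Rightarrow> nat" where enc: "inj_on enc ?L"
    by (metis finite_imp_inj_to_nat_seg)
  \<comment> \<open>The vertices are numbers standing for blocks, which \<open>dec\<close> recovers.\<close>
  define dec where "dec = the_inv_into ?L enc"
  have dec: "dec (enc b) = b" if "b \<in> ?L" for b
    using that enc by (simp add: dec_def the_inv_into_f_f)
  define V where "V = enc ` ?L"
  define H where "H = (\<lambda>i. \<lparr>pverts = V, parcs = {(m, n) \<in> V \<times> V. overlap N i (dec m) (dec n)}\<rparr>)"
  have V: "dec n \<in> ?L" "enc (dec n) = n" if "n \<in> V" for n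
    using that dec by (auto simp: V_def)
  have "finite V" using fin by (simp add: V_def)
  have "kgraph V H"
    unfolding kgraph_def
  proof (intro conjI allI)
    fix i
    show "pair_fin_digraph (H i)"
    proof
      show "finite (parcs (H i))"
        by (rule finite_subset[of _ "V \<times> V"]) (auto simp: H_def \<open>finite V\<close>)
    qed (use \<open>finite V\<close> in \<open>auto simp: H_def\<close>)
  qed (simp_all add: H_def \<open>finite V\<close>)
  moreover have "conjugate A X V (graph_shift V H)"
  proof -
    define f where "f = (\<lambda>x v. enc (window N x v))"
    define g :: "('k, nat) config \<Rightarrow> ('k, 'a) config" where "g = (\<lambda>y v. dec (y v) 0)"
    have X_iff: "x \<in> X \<longleftrightarrow> (\<forall>v. window N x v \<in> ?L)" for x
      unfolding X using N by (intro shift_space_iff_legal_windows) auto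
    have Y_iff: "y \<in> graph_shift V H \<longleftrightarrow>
        (\<forall>v. y v \<in> V) \<and> (\<forall>v i. overlap N i (dec (y v)) (dec (y (v + axis i 1))))" for y
      by (auto simp: graph_shift_def full_shift_def H_def)
    have f: "f x \<in> graph_shift V H" if "x \<in> X" for x
      using that by (simp add: X_iff Y_iff f_def dec overlap_window) (simp add: V_def)
    have win: "window N (g y) v = dec (y v)" if "y \<in> graph_shift V H" for y v
      unfolding g_def using that V by (intro window_center[where A = A and \<F> = \<F>]) (auto simp: Y_iff)
    have g: "g y \<in> X" if "y \<in> graph_shift V H" for y
      using that V by (simp add: X_iff win) (simp add: Y_iff)
    have fg: "f (g y) = y" if "y \<in> graph_shift V H" for y
      using that V by (auto simp: f_def win Y_iff)
    have gf: "g (f x) = x" if "x \<in> X" for x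
      using that N(1) by (auto simp: g_def f_def X_iff dec window_def box_at_origin_def)
    have subX: "X \<subseteq> topspace (full_shift A)"
      by (auto simp: X shift_space_def)
    have subY: "graph_shift V H \<subseteq> topspace (full_shift V)"
      by (auto simp: graph_shift_def)
    have "continuous_map (subtopology (full_shift A) X)
        (subtopology (full_shift V) (graph_shift V H)) f"
    proof (rule continuous_map_local[OF subX subY f])
      show "finite ((+) v ` box_at_origin N)" for v :: "int ^ 'k"
        by (simp add: finite_box_at_origin)
      show "f z v = f x v" if "\<And>w. w \<in> (+) v ` box_at_origin N \<Longrightarrow> z w = x w" for v x z
        unfolding f_def window_def using that by (intro arg_cong[where f = enc] restrict_ext) auto
    qed
    moreover have "continuous_map (subtopology (full_shift V) (graph_shift V H))
        (subtopology (full_shift A) X) g"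
      by (rule continuous_map_local[OF subY subX g, where S = "\<lambda>v. {v}"]) (auto simp: g_def)
    ultimately have "homeomorphic_maps (subtopology (full_shift A) X)
        (subtopology (full_shift V) (graph_shift V H)) f g"
      using fg gf by (auto simp: homeomorphic_maps_def)
    moreover have "f (shift a x) = shift a (f x)" for a x
      by (simp add: f_def shift_def window_def ac_simps)
    moreover have "is_shift_space A X"
      using \<F>(2) X by (auto simp: is_shift_space_def)
    ultimately show ?thesis
      unfolding conjugate_def using is_shift_space_graph_shift homeomorphic_map_maps by blast
  qed
  ultimately show ?thesis by blast
qed

end
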